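(* Suppose $\mathcal C\subset\mathbb R^{l_1+l_2}$ is a full-dimensional closed and bounded convex set contained in a ball of diameter $D\ge1$. Consider applying Algorithm 6 (described in the context) to solve $$(\star)\qquad \min\{c^\top x:\ Ax=b,\ x\in\mathcal C,\ x\in\mathbb Z^{l_1}\times\mathbb R^{l_2}\}.$$ If the accuracy parameters $\epsilon_1,\epsilon_2>0$ of Algorithm 6 are set so that $\epsilon_1=\epsilon_2^2$ and $\epsilon_2<\frac1{64}\min\{1,D\}$, then: (a) Algorithm 6 terminates after a finite number of iterations. (b) If Algorithm 6 returns infeasible status, then $(\star)$ is $(20D\sqrt{\epsilon_2})$-infeasible. (c) If Algorithm 6 returns a solution $x^{(m)}$, then $x^{(m)}$ is a $(20\lambda D\sqrt{\epsilon_2}\,\|c\|,\ 20D\sqrt{\epsilon_2},\ \lambda)$-accurate solution of $(\star)$, given that $(\star)$ is $(20D\sqrt{\epsilon_2},\lambda)$-stable.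
   Context: Norms are Euclidean. For $\epsilon>0$ let $\mathcal C^\epsilon_+=\{x:\exists z\in\mathcal C,\ \|x-z\|\le\epsilon\}$ and $\mathcal C^\epsilon_-=\mathcal C\setminus\bigcup_{x\in\mathrm{bd}(\mathcal C)}B(x,\epsilon)$, with $B(x,\epsilon)$ the closed ball of radius $\epsilon$ about $x$. Write $x_Z$ for the first $l_1$ components of $x$. - For a convex problem $\min\{f(x): Ax=b,\ x\in\mathcal C\}$ (equality constraints possibly absent), a point $x$ is an $(\epsilon,\epsilon')$-accurate solution if the problem is feasible, $x\in\mathcal C^{\epsilon'}_+$ and $\mathrm{OPT}-\epsilon\le f(x)\le\mathrm{OPT}+\epsilon$, with $\mathrm{OPT}$ the optimal value. For a mixed-integer problem $\min\{f(x): Ax=b,\ x\in\mathcal C,\ x\in\mathbb Z^{l_1}\times\mathbb R^{l_2}\}$: - it is $\epsilon$-feasible (resp. $\epsilon$-infeasible) if $\mathcal C^\epsilon_-\cap\{Ax=b\}\cap(\mathbb Z^{l_1}\times\mathbb R^{l_2})$ is non-empty (resp. empty); - it is $(\epsilon,\lambda)$-stable ($\lambda>0$) if it is $\epsilon$-feasible and there exist an optimal solution $x^1$ of $\min\{f(x): Ax=b,\ x\in\mathcal C^\epsilon_+,\ x\in\mathbb Z^{l_1}\times\mathbb R^{l_2}\}$ and an optimal solution $x^2$ of $\min\{f(x): Ax=b,\ x\in\mathcal C^\epsilon_-,\ x\in\mathbb Z^{l_1}\times\mathbb R^{l_2}\}$ with $x^1_Z=x^2_Z$ and $\|x^1-x^2\|\le\lambda\epsilon$;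 - $x\in\mathbb Z^{l_1}\times\mathbb R^{l_2}$ is an $(\epsilon,\epsilon',\lambda)$-accurate solution if the problem is $(\epsilon',\lambda)$-stable, $x\in\mathcal C^{\epsilon'}_+$, and $\mathrm{OPT}-\epsilon\le f(x)\le\mathrm{OPT}+\epsilon$, with $\mathrm{OPT}$ the optimal value. Oracle assumption: for any $\epsilon,\epsilon'>0$ there is an oracle that finds an $(\epsilon,\epsilon')$-accurate solution of any feasible convex optimization problem. Linear programs are solved exactly. Algorithm 6 (parameters $\epsilon_1,\epsilon_2>0$). At iteration $n=1,2,\dots$: solve to optimality the master problem of minimizing $c^\top x$ over $x\in\mathbb Z^{l_1}\times\mathbb R^{l_2}$ subject to $Ax=b$ and $(x^{(k)}-z^{(k)})^\top x\le(x^{(k)}-z^{(k)})^\top z^{(k)}$ for $k\in[n-1]$. If it is infeasible, stop and return infeasible status; otherwise let $x^{(n)}$ be the solution. If $x^{(n)}\in\mathcal C$, stop and return $x^{(n)}$. Otherwise solve the projection problem $\min\{\|z-x^{(n)}\|^2: z\in\mathcal C\}$ to $(\epsilon_1,\epsilon_1)$-accuracy, and let $z^{(n)}$ and $d^{(n)}$ be respectively an $(\epsilon_1,\epsilon_1)$-accurate solution and its objective value. If $d^{(n)}\le\epsilon_2/2$, stop and return $x^{(n)}$; otherwise add the cut $(x^{(n)}-z^{(n)})^\top x\le(x^{(n)}-z^{(n)})^\top z^{(n)}$ to the master problem and go to iteration $n+1$. *)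

theory Defs
  imports "HOL-Analysis.Analysis"
begin

definition enlarge :: "real \<Rightarrow> (real ^ 'n) set \<Rightarrow> (real ^ 'n) set" where
  "enlarge \<epsilon> C = {x. \<exists>z\<in>C. norm (x - z) \<le> \<epsilon>}"

definition shrink :: "real \<Rightarrow> (real ^ 'n) set \<Rightarrow> (real ^ 'n) set" where
  "shrink \<epsilon> C = C - (\<Union>x\<in>frontier C. cball x \<epsilon>)"

(* J is the set of indices of the integer coordinates. For J with l1 elements this is
   Z^l1 x R^l2 up to the numbering of the coordinates, with l1 = 0 and l2 = 0 allowed. *)
definition mixed_integer :: "'n set \<Rightarrow> (real ^ 'n) set" where
  "mixed_integer J = {x. \<forall>i\<in>J. x $ i \<in> \<int>}"

(* Extended-real valued: an unbounded problem has value -\<infinity>, an infeasible one \<infinity>. *)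
definition opt_value :: "('a \<Rightarrow> real) \<Rightarrow> 'a set \<Rightarrow> ereal" where
  "opt_value f S = (INF x\<in>S. ereal (f x))"

definition optimal_solution :: "('a \<Rightarrow> real) \<Rightarrow> 'a set \<Rightarrow> 'a \<Rightarrow> bool" where
  "optimal_solution f S x \<longleftrightarrow> is_arg_min f (\<lambda>y. y \<in> S) x"

(* E is the solution set of the equality constraints, UNIV if there are none. *)
definition accurate_solution ::
  "(real ^ 'n \<Rightarrow> real) \<Rightarrow> (real ^ 'n) set \<Rightarrow> (real ^ 'n) set \<Rightarrow> real \<Rightarrow> real \<Rightarrow> real ^ 'n \<Rightarrow> bool" where
  "accurate_solution f E C \<epsilon> \<epsilon>' x \<longleftrightarrow>
     E \<inter> C \<noteq> {} \<and> x \<in> enlarge \<epsilon>' C \<and>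
     opt_value f (E \<inter> C) - ereal \<epsilon> \<le> ereal (f x) \<and>
     ereal (f x) \<le> opt_value f (E \<inter> C) + ereal \<epsilon>"

definition mip_feasible_set ::
  "real ^ 'n ^ 'm \<Rightarrow> real ^ 'm \<Rightarrow> (real ^ 'n) set \<Rightarrow> 'n set \<Rightarrow> (real ^ 'n) set" where
  "mip_feasible_set A b C J = {x. A *v x = b} \<inter> C \<inter> mixed_integer J"

definition mip_eps_feasible ::
  "real ^ 'n ^ 'm \<Rightarrow> real ^ 'm \<Rightarrow> (real ^ 'n) set \<Rightarrow> 'n set \<Rightarrow> real \<Rightarrow> bool" where
  "mip_eps_feasible A b C J \<epsilon> \<longleftrightarrow> mip_feasible_set A b (shrink \<epsilon> C) J \<noteq> {}"

definition mip_eps_infeasible ::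
  "real ^ 'n ^ 'm \<Rightarrow> real ^ 'm \<Rightarrow> (real ^ 'n) set \<Rightarrow> 'n set \<Rightarrow> real \<Rightarrow> bool" where
  "mip_eps_infeasible A b C J \<epsilon> \<longleftrightarrow> mip_feasible_set A b (shrink \<epsilon> C) J = {}"

definition mip_stable ::
  "(real ^ 'n \<Rightarrow> real) \<Rightarrow> real ^ 'n ^ 'm \<Rightarrow> real ^ 'm \<Rightarrow> (real ^ 'n) set \<Rightarrow> 'n set \<Rightarrow>
   real \<Rightarrow> real \<Rightarrow> bool" where
  "mip_stable f A b C J \<epsilon> lam \<longleftrightarrow>
     mip_eps_feasible A b C J \<epsilon> \<and>
     (\<exists>x1 x2. optimal_solution f (mip_feasible_set A b (enlarge \<epsilon> C) J) x1 \<and>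
              optimal_solution f (mip_feasible_set A b (shrink \<epsilon> C) J) x2 \<and>
              (\<forall>i\<in>J. x1 $ i = x2 $ i) \<and> norm (x1 - x2) \<le> lam * \<epsilon>)"

definition mip_accurate_solution ::
  "(real ^ 'n \<Rightarrow> real) \<Rightarrow> real ^ 'n ^ 'm \<Rightarrow> real ^ 'm \<Rightarrow> (real ^ 'n) set \<Rightarrow> 'n set \<Rightarrow>
   real \<Rightarrow> real \<Rightarrow> real \<Rightarrow> real ^ 'n \<Rightarrow> bool" where
  "mip_accurate_solution f A b C J \<epsilon> \<epsilon>' lam x \<longleftrightarrow>
     x \<in> mixed_integer J \<and> mip_stable f A b C J \<epsilon>' lam \<and> x \<in> enlarge \<epsilon>' C \<and>
     opt_value f (mip_feasible_set A b C J) - ereal \<epsilon> \<le> ereal (f x) \<and>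
     ereal (f x) \<le> opt_value f (mip_feasible_set A b C J) + ereal \<epsilon>"

(* The list holds the pairs (x^(k), z^(k)) of the previous iterations. *)
definition master_feasible_set ::
  "real ^ 'n ^ 'm \<Rightarrow> real ^ 'm \<Rightarrow> 'n set \<Rightarrow> ((real ^ 'n) \<times> (real ^ 'n)) list \<Rightarrow> (real ^ 'n) set" where
  "master_feasible_set A b J cuts =
     {x \<in> mixed_integer J. A *v x = b \<and>
        (\<forall>(xk, zk)\<in>set cuts. (xk - zk) \<bullet> x \<le> (xk - zk) \<bullet> zk)}"

datatype 'v cut_state =
    Iterating "('v \<times> 'v) list"
  | Infeasible
  | Returned 'v

(* One iteration of the cutting-plane algorithm. It is a relation because the master solver may
   return any optimal solution and the projection oracle any (e1, e1)-accurate solution. *)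
inductive cut_step ::
  "real ^ 'n \<Rightarrow> real ^ 'n ^ 'm \<Rightarrow> real ^ 'm \<Rightarrow> (real ^ 'n) set \<Rightarrow> 'n set \<Rightarrow> real \<Rightarrow> real \<Rightarrow>
   (real ^ 'n) cut_state \<Rightarrow> (real ^ 'n) cut_state \<Rightarrow> bool"
  for c A b C J e1 e2 where
  infeasible:
    "master_feasible_set A b J cuts = {} \<Longrightarrow>
     cut_step c A b C J e1 e2 (Iterating cuts) Infeasible"
| return_member:
    "optimal_solution (\<lambda>y. c \<bullet> y) (master_feasible_set A b J cuts) x \<Longrightarrow> x \<in> C \<Longrightarrow>
     cut_step c A b C J e1 e2 (Iterating cuts) (Returned x)"
| return_close:
    "optimal_solution (\<lambda>y. c \<bullet> y) (master_feasible_set A b J cuts) x \<Longrightarrow> x \<notin> C \<Longrightarrow>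
     accurate_solution (\<lambda>y. (norm (y - x))\<^sup>2) UNIV C e1 e1 z \<Longrightarrow>
     (norm (z - x))\<^sup>2 \<le> e2 / 2 \<Longrightarrow>
     cut_step c A b C J e1 e2 (Iterating cuts) (Returned x)"
| add_cut:
    "optimal_solution (\<lambda>y. c \<bullet> y) (master_feasible_set A b J cuts) x \<Longrightarrow> x \<notin> C \<Longrightarrow>
     accurate_solution (\<lambda>y. (norm (y - x))\<^sup>2) UNIV C e1 e1 z \<Longrightarrow>
     (norm (z - x))\<^sup>2 > e2 / 2 \<Longrightarrow>
     cut_step c A b C J e1 e2 (Iterating cuts) (Iterating (cuts @ [(x, z)]))"

definition cut_reachable ::
  "real ^ 'n \<Rightarrow> real ^ 'n ^ 'm \<Rightarrow> real ^ 'm \<Rightarrow> (real ^ 'n) set \<Rightarrow> 'n set \<Rightarrow> real \<Rightarrow> real \<Rightarrow>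
   (real ^ 'n) cut_state \<Rightarrow> bool" where
  "cut_reachable c A b C J e1 e2 s \<longleftrightarrow> (cut_step c A b C J e1 e2)\<^sup>*\<^sup>* (Iterating []) s"

(* No execution is infinite, and none gets stuck before producing an output, except possibly at a
   feasible master problem with no optimal solution (an unbounded one, say): there the
   instruction to solve it to optimality is void. *)
definition cut_terminates ::
  "real ^ 'n \<Rightarrow> real ^ 'n ^ 'm \<Rightarrow> real ^ 'm \<Rightarrow> (real ^ 'n) set \<Rightarrow> 'n set \<Rightarrow> real \<Rightarrow> real \<Rightarrow> bool" where
  "cut_terminates c A b C J e1 e2 \<longleftrightarrow>
     (\<nexists>s. s 0 = Iterating [] \<and> (\<forall>i::nat. cut_step c A b C J e1 e2 (s i) (s (Suc i)))) \<and>
     (\<forall>cuts. cut_reachable c A b C J e1 e2 (Iterating cuts) \<longrightarrow>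
        (master_feasible_set A b J cuts \<noteq> {} \<longrightarrow>
           (\<exists>x. optimal_solution (\<lambda>y. c \<bullet> y) (master_feasible_set A b J cuts) x)) \<longrightarrow>
        (\<exists>s. cut_step c A b C J e1 e2 (Iterating cuts) s))"

end

theory Submission
  imports Defs
begin

text \<open>
  Let \<open>p\<close> be the exact projection of \<open>x\<close> onto \<open>C\<close>. An approximate projection \<open>z\<close> satisfies
  \<open>\<parallel>z - p\<parallel> \<le> e2 (1 + \<parallel>x - p\<parallel>)\<close>, so the cut at \<open>z\<close> is a perturbation of the cut at \<open>p\<close>, and the
  latter holds with slack \<open>\<epsilon> \<parallel>x - p\<parallel>\<close> at every centre of an \<open>\<epsilon>\<close>-ball inside \<open>C\<close>. Hence no cut removes
  a point of the shrunken set: this gives (b), and it sandwiches the value of a returned point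
  between the optimal values over the enlarged and the shrunken set, which gives (c).

  For (a), the iterates need not be bounded, but the \<open>z\<close> and the unit vectors \<open>u\<close> along \<open>x - z\<close> are.
  An infinite run would thus have two iterations \<open>n < m\<close> with \<open>z\<^sub>n\<close>, \<open>z\<^sub>m\<close> close together and
  \<open>u\<^sub>n\<close>, \<open>u\<^sub>m\<close> nearly parallel; as \<open>x\<^sub>m\<close> is at least \<open>sqrt (e2 / 2)\<close> away from \<open>z\<^sub>m\<close>, it would violate
  the \<open>n\<close>-th cut.
\<close>

section \<open>Enlarging and shrinking a set\<close>

lemma enlarge_superset: "0 \<le> \<epsilon> \<Longrightarrow> C \<subseteq> enlarge \<epsilon> C"
  unfolding enlarge_def by (auto intro!: bexI)

lemma bounded_enlarge:
  assumes "bounded C" shows "bounded (enlarge \<epsilon> C)"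
proof -
  obtain B where B: "\<And>z. z \<in> C \<Longrightarrow> norm z \<le> B"
    using assms unfolding bounded_iff by blast
  have "norm x \<le> B + \<epsilon>" if x: "x \<in> enlarge \<epsilon> C" for x
  proof -
    obtain z where "z \<in> C" "norm (x - z) \<le> \<epsilon>"
      using x unfolding enlarge_def by blast
    then show ?thesis
      using B[of z] norm_triangle_ineq[of "x - z" z] by simp
  qed
  then show ?thesis unfolding bounded_iff by blast
qed

text \<open>A segment from \<open>y\<close> to a point outside \<open>C\<close> crosses
  \<open>frontier C\<close>; if it stayed inside the ball, the crossing point would be within
  \<epsilon> of \<open>y\<close>, which \<open>shrink\<close> forbids.\<close>

lemma cball_subset_of_mem_shrink:
  assumes "y \<in> shrink \<epsilon> C" "0 \<le> \<epsilon>"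
  shows "cball y \<epsilon> \<subseteq> C"
proof
  fix w assume w: "w \<in> cball y \<epsilon>"
  show "w \<in> C"
  proof (rule ccontr)
    assume "w \<notin> C"
    moreover have "y \<in> C" using assms unfolding shrink_def by blast
    ultimately have "closed_segment y w \<inter> frontier C \<noteq> {}"
      by (intro connected_Int_frontier) auto
    then obtain v where "v \<in> closed_segment y w" "v \<in> frontier C" by blast
    moreover have "closed_segment y w \<subseteq> cball y \<epsilon>"
      using w \<open>0 \<le> \<epsilon>\<close> by (intro closed_segment_subset) auto
    ultimately show False
      using assms unfolding shrink_def by (auto simp: dist_commute)
  qed
qed

section \<open>Approximate projections and their cuts\<close>

lemma opt_value_projection:
  assumes "closed C" "C \<noteq> {}"
  shows "opt_value (\<lambda>y. (norm (y - x))\<^sup>2) C = ereal ((norm (closest_point C x - x))\<^sup>2)"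
proof (rule antisym)
  show "opt_value (\<lambda>y. (norm (y - x))\<^sup>2) C \<le> ereal ((norm (closest_point C x - x))\<^sup>2)"
    unfolding opt_value_def by (rule INF_lower) (rule closest_point_in_set[OF assms])
  have "norm (closest_point C x - x) \<le> norm (y - x)" if "y \<in> C" for y
    using closest_point_le[OF assms(1) that, of x] by (simp add: dist_norm norm_minus_commute)
  then show "ereal ((norm (closest_point C x - x))\<^sup>2) \<le> opt_value (\<lambda>y. (norm (y - x))\<^sup>2) C"
    unfolding opt_value_def by (intro INF_greatest) (simp add: power_mono)
qed

lemma accurate_projection_iff:
  assumes "closed C" "C \<noteq> {}"
  shows "accurate_solution (\<lambda>y. (norm (y - x))\<^sup>2) UNIV C \<epsilon> \<epsilon>' z \<longleftrightarrow>
    z \<in> enlarge \<epsilon>' C \<and> \<bar>(norm (z - x))\<^sup>2 - (norm (closest_point C x - x))\<^sup>2\<bar> \<le> \<epsilon>"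
  using assms by (auto simp: accurate_solution_def opt_value_projection)

text \<open>Moving \<open>y\<close> by \<epsilon> in the direction of \<open>u\<close> stays in
  \<open>C\<close> and raises the inner product with \<open>u\<close> by exactly
  \<open>\<epsilon> * norm u\<close>, so that much slack must be available at
  \<open>y\<close>.\<close>

lemma inner_le_of_cball_subset:
  fixes u y :: "'a::real_inner"
  assumes "cball y \<epsilon> \<subseteq> C" "0 \<le> \<epsilon>" "\<And>w. w \<in> C \<Longrightarrow> u \<bullet> (w - p) \<le> 0"
  shows "u \<bullet> (y - p) \<le> - \<epsilon> * norm u"
proof (cases "u = 0")
  case False
  have "y + (\<epsilon> / norm u) *\<^sub>R u \<in> C"
    using assms(1,2) False by (intro subsetD[OF assms(1)]) (simp add: dist_norm)
  then have "u \<bullet> (y + (\<epsilon> / norm u) *\<^sub>R u - p) \<le> 0" by (rule assms(3))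
  moreover have "u \<bullet> ((\<epsilon> / norm u) *\<^sub>R u) = \<epsilon> * norm u"
    using False by (simp add: dot_square_norm power2_eq_square)
  ultimately show ?thesis by (simp add: inner_diff_right inner_add_right)
qed simp

text \<open>With \<open>u\<close>, \<open>q\<close>, \<open>v\<close> as below, the claim is that
  the inner product of \<open>u - q\<close> and \<open>v - q\<close> is nonpositive. Its main term,
  that of \<open>u\<close> and \<open>v\<close>, is at most
  \<open>- (20 * D * r) * \<delta>\<close>. The remaining terms are at most
  \<open>2 * (e * (1 + \<delta>) * D)\<close>, and the lower bound \<open>r / 2\<close> for \<delta>
  makes the main term dominate.\<close>

lemma projection_cut_valid:
  fixes x y z :: "real ^ 'n"
  assumes C: "convex C" "closed C" and diam: "\<And>v w. v \<in> C \<Longrightarrow> w \<in> C \<Longrightarrow> norm (v - w) \<le> D"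
    and D: "D \<ge> 1" and e: "0 < e" "e < 1 / 64"
    and z: "z \<in> enlarge (e\<^sup>2) C"
      "\<bar>(norm (z - x))\<^sup>2 - (norm (closest_point C x - x))\<^sup>2\<bar> \<le> e\<^sup>2" "(norm (z - x))\<^sup>2 > e / 2"
    and y: "cball y (20 * D * sqrt e) \<subseteq> C"
  shows "(x - z) \<bullet> y \<le> (x - z) \<bullet> z"
proof -
  define p where "p = closest_point C x"
  define u q v \<delta> r where "u = x - p" "q = z - p" "v = y - p" "\<delta> = norm u" "r = sqrt e"
  note defs = u_q_v_\<delta>_r_def
  have r: "r > 0" "r\<^sup>2 = e" using e by (auto simp: defs)
  have "r \<le> 1 / 8" unfolding defs using e by (intro real_le_lsqrt) (auto simp: power2_eq_square)
  have yC: "y \<in> C" using y D e by auto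
  have pC: "p \<in> C"
    unfolding p_def using closest_point_in_set[OF C(2)] yC by blast
  have proj: "u \<bullet> (w - p) \<le> 0" if "w \<in> C" for w
    using closest_point_dot[OF C that] unfolding defs p_def .
  have uv: "u \<bullet> v \<le> - (20 * D * r) * \<delta>"
    using inner_le_of_cball_subset[OF y _ proj] D e unfolding defs by auto
  have \<delta>0: "\<delta> \<ge> 0" by (simp add: defs)
  have nx: "norm (closest_point C x - x) = \<delta>" by (simp add: defs p_def norm_minus_commute)
  have ee: "e\<^sup>2 \<le> e / 64" using e by (simp add: power2_eq_square)
  \<comment> \<open>The test for adding a cut and the oracle accuracy leave at least
    \<open>e / 2 - e / 64\<close>, more than \<open>e / 4\<close>.\<close>
  have "\<delta>\<^sup>2 \<ge> (r / 2)\<^sup>2"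
    using z(2,3) nx ee r e by (simp add: power_divide)
  then have \<delta>: "r / 2 \<le> \<delta>" using \<delta>0 by (rule power2_le_imp_le)
  have "z - x = q - u" by (simp add: defs)
  then have "(norm (z - x))\<^sup>2 = (norm q)\<^sup>2 - 2 * (u \<bullet> q) + \<delta>\<^sup>2"
    by (simp add: defs(4) power2_norm_eq_inner inner_diff_left inner_diff_right inner_commute)
  then have q1: "(norm q)\<^sup>2 - 2 * (u \<bullet> q) \<le> e\<^sup>2" using z(2) nx by simp
  obtain w where w: "w \<in> C" "norm (z - w) \<le> e\<^sup>2" using z(1) unfolding enlarge_def by blast
  \<comment> \<open>\<open>z\<close> may lie outside \<open>C\<close>, so the variational inequality
    of the projection is applied to the nearby \<open>w\<close> instead.\<close>
  have "u \<bullet> q = u \<bullet> (w - p) + u \<bullet> (z - w)" by (simp add: defs inner_diff_right)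
  also have "\<dots> \<le> 0 + \<delta> * e\<^sup>2"
    using proj[OF w(1)] norm_cauchy_schwarz[of u "z - w"] mult_left_mono[OF w(2) \<delta>0]
    by (simp add: defs)
  finally have q2: "(norm q)\<^sup>2 \<le> e\<^sup>2 + 2 * \<delta> * e\<^sup>2" using q1 by simp
  \<comment> \<open>Completing the square adds only \<open>(e * \<delta>)\<^sup>2\<close>.\<close>
  also have "\<dots> \<le> (e * (1 + \<delta>))\<^sup>2"
    using \<delta>0 e by (simp add: power2_eq_square algebra_simps)
  finally have q3: "norm q \<le> e * (1 + \<delta>)"
    using e \<delta>0 by (intro power2_le_imp_le[of "norm q"]) auto
  have "- (q \<bullet> v) \<le> norm q * norm v" using norm_cauchy_schwarz[of "- q" v] by simp
  also have "\<dots> \<le> e * (1 + \<delta>) * D"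
    using q3 diam[OF yC pC] e \<delta>0 by (intro mult_mono) (auto simp: defs)
  finally have qv: "- (q \<bullet> v) \<le> e * (1 + \<delta>) * D" .
  have "(x - z) \<bullet> (y - z) = (u - q) \<bullet> (v - q)" by (simp add: defs)
  also have "\<dots> = u \<bullet> v - u \<bullet> q - q \<bullet> v + (norm q)\<^sup>2"
    by (simp add: power2_norm_eq_inner inner_diff_left inner_diff_right inner_commute)
  \<comment> \<open>Half the sum of \<open>q1\<close> and \<open>q2\<close> bounds the two terms
    without \<open>v\<close> by \<open>e\<^sup>2 * (1 + \<delta>)\<close>.\<close>
  also have "\<dots> \<le> - (20 * D * r) * \<delta> + e\<^sup>2 * (1 + \<delta>) + e * (1 + \<delta>) * D"
    using uv q1 q2 qv by (simp add: algebra_simps)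
  also have "\<dots> \<le> - (20 * D * r) * \<delta> + 2 * (e * (1 + \<delta>) * D)"
  proof -
    have "e\<^sup>2 * (1 + \<delta>) \<le> e * D * (1 + \<delta>)"
      using e D \<delta>0 ee by (intro mult_right_mono) (auto simp: power2_eq_square)
    then show ?thesis by (simp add: algebra_simps)
  qed
  also have "\<dots> \<le> 0"
  proof -
    \<comment> \<open>As \<open>e\<close> is the square of \<open>r\<close>, this bounds the error
      \<open>2 * D * e * (1 + \<delta>)\<close> by \<open>6 * D * r * \<delta>\<close>, well within
      the slack.\<close>
    have "r * (1 + \<delta>) \<le> 2 * \<delta> + \<delta>"
      using \<delta> \<open>r \<le> 1 / 8\<close> \<delta>0 mult_right_mono[of r 1 \<delta>] by (simp add: algebra_simps)
    then have "(2 * D * r) * (r * (1 + \<delta>)) \<le> (2 * D * r) * (3 * \<delta>)"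
      using D r by (intro mult_left_mono) auto
    moreover have "0 \<le> D * r * \<delta>" using D r \<delta>0 by simp
    ultimately show ?thesis
      unfolding r(2)[symmetric] by (simp add: power2_eq_square algebra_simps)
  qed
  finally show ?thesis by (simp add: inner_diff_right)
qed

section \<open>Finiteness by compactness\<close>

lemma no_infinite_separating_sequence:
  fixes X Z :: "nat \<Rightarrow> 'a::euclidean_space"
  assumes bdd: "bounded (range Z)" and \<rho>: "0 < \<rho>" "\<And>n. \<rho> \<le> norm (X n - Z n)"
    and cut: "\<And>m n. n < m \<Longrightarrow> (X n - Z n) \<bullet> X m \<le> (X n - Z n) \<bullet> Z n"
  shows False
proof -
  define P where "P n = (Z n, sgn (X n - Z n))" for n
  have "range P \<subseteq> range Z \<times> cball 0 1"
    by (auto simp: P_def norm_sgn)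
  then have "bounded (range P)"
    using bdd bounded_Times bounded_cball bounded_subset by blast
  then obtain l \<phi> where "strict_mono \<phi>" "(P \<circ> \<phi>) \<longlonglongrightarrow> l"
    using bounded_imp_convergent_subsequence by blast
  \<comment> \<open>The bound \<open>1 / 2\<close> keeps the inner product of the two directions
    above \<open>1 / 2\<close>, so the step from \<open>Z m\<close> to \<open>X m\<close> gains at
    least \<open>\<rho> / 2\<close> along \<open>u\<close>; the bound \<open>\<rho> / 2\<close>
    makes the loss from \<open>Z n\<close> to \<open>Z m\<close> strictly smaller.\<close>
  moreover define \<eta> where "\<eta> = min (\<rho> / 2) (1 / 2)"
  have \<eta>0: "\<eta> > 0" using \<rho> by (simp add: \<eta>_def)
  ultimately obtain N where N: "\<And>m n. N \<le> m \<Longrightarrow> N \<le> n \<Longrightarrow> dist (P (\<phi> m)) (P (\<phi> n)) < \<eta>"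
    using LIMSEQ_imp_Cauchy[of "P \<circ> \<phi>"] unfolding Cauchy_def comp_def by blast
  define n m where "n = \<phi> N" "m = \<phi> (Suc N)"
  define u v where "u = sgn (X n - Z n)" "v = sgn (X m - Z m)"
  note defs = n_m_def u_v_def
  have "n < m" using \<open>strict_mono \<phi>\<close> by (simp add: defs strict_mono_less)
  have "dist (P m) (P n) < \<eta>" using N by (simp add: defs)
  then have close: "norm (Z m - Z n) < \<eta>" "norm (v - u) < \<eta>"
    using dist_fst_le[of "P m" "P n"] dist_snd_le[of "P m" "P n"]
    by (auto simp: P_def dist_norm u_v_def)
  have "X n - Z n \<noteq> 0" using \<rho>(1) \<rho>(2)[of n] by auto
  then have u: "norm u = 1" by (simp add: u_v_def norm_sgn)
  have "u \<bullet> v = 1 + u \<bullet> (v - u)"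
    using u by (simp add: inner_diff_right dot_square_norm)
  moreover have "\<bar>u \<bullet> (v - u)\<bar> < \<eta>"
    using Cauchy_Schwarz_ineq2[of u "v - u"] u close by simp
  ultimately have uv: "u \<bullet> v > 1 / 2" unfolding \<eta>_def by linarith
  have "X m = Z m + norm (X m - Z m) *\<^sub>R v"
    by (cases "X m = Z m") (simp_all add: u_v_def sgn_div_norm)
  then have "u \<bullet> (X m - Z n) = u \<bullet> (Z m - Z n) + norm (X m - Z m) * (u \<bullet> v)"
    by (metis add_diff_eq add.commute inner_add_right inner_scaleR_right)
  moreover have "\<bar>u \<bullet> (Z m - Z n)\<bar> < \<rho> / 2"
    using Cauchy_Schwarz_ineq2[of u "Z m - Z n"] u close unfolding \<eta>_def by simp
  moreover have "norm (X m - Z m) * (u \<bullet> v) \<ge> \<rho> * (1 / 2)"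
    using \<rho>(1) \<rho>(2)[of m] uv by (intro mult_mono) auto
  ultimately have "u \<bullet> (X m - Z n) > 0" by linarith
  moreover have "u \<bullet> (X m - Z n) = inverse (norm (X n - Z n)) * ((X n - Z n) \<bullet> (X m - Z n))"
    by (simp add: u_v_def sgn_div_norm)
  moreover have "(X n - Z n) \<bullet> (X m - Z n) \<le> 0"
    using cut[OF \<open>n < m\<close>] by (simp add: inner_diff_right)
  ultimately show False
    by (metis inverse_nonnegative_iff_nonnegative mult_nonneg_nonpos norm_ge_zero not_less)
qed

section \<open>Executions of the algorithm and their outputs\<close>

definition valid_cut :: "(real ^ 'n) set \<Rightarrow> real \<Rightarrow> real \<Rightarrow> (real ^ 'n) \<times> (real ^ 'n) \<Rightarrow> bool" where
  "valid_cut C e1 e2 = (\<lambda>(x, z).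
     accurate_solution (\<lambda>y. (norm (y - x))\<^sup>2) UNIV C e1 e1 z \<and> (norm (z - x))\<^sup>2 > e2 / 2)"

text \<open>\<open>valid_cut\<close> only records the oracle accuracy and the distance test under
  which a pair was added; that the cut spares the shrunken set is derived from it in
  \<open>shrink_subset_master\<close>.\<close>

lemma reachable_cuts_valid:
  assumes "cut_reachable c A b C J e1 e2 (Iterating cuts)"
  shows "\<forall>k\<in>set cuts. valid_cut C e1 e2 k"
proof -
  have "\<forall>cuts. s = Iterating cuts \<longrightarrow> (\<forall>k\<in>set cuts. valid_cut C e1 e2 k)"
    if "(cut_step c A b C J e1 e2)\<^sup>*\<^sup>* (Iterating []) s" for s
    using that
  proof (induction rule: rtranclp_induct)
    case (step s t)
    from step.hyps(2) step.IH show ?case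
      by cases (auto simp: valid_cut_def)
  qed simp
  then show ?thesis using assms unfolding cut_reachable_def by blast
qed

lemma reachable_InfeasibleE:
  assumes "cut_reachable c A b C J e1 e2 Infeasible"
  obtains cuts where "cut_reachable c A b C J e1 e2 (Iterating cuts)"
    "master_feasible_set A b J cuts = {}"
  using assms unfolding cut_reachable_def
  by (cases rule: rtranclp.cases) (auto elim: cut_step.cases)

lemma reachable_ReturnedE:
  assumes "cut_reachable c A b C J e1 e2 (Returned x)"
  obtains cuts where "cut_reachable c A b C J e1 e2 (Iterating cuts)"
    "optimal_solution (\<lambda>y. c \<bullet> y) (master_feasible_set A b J cuts) x"
    "x \<in> C \<or> (\<exists>z. accurate_solution (\<lambda>y. (norm (y - x))\<^sup>2) UNIV C e1 e1 z \<and> (norm (z - x))\<^sup>2 \<le> e2 / 2)"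
proof -
  obtain s where s: "(cut_step c A b C J e1 e2)\<^sup>*\<^sup>* (Iterating []) s"
    "cut_step c A b C J e1 e2 s (Returned x)"
    using assms unfolding cut_reachable_def by (cases rule: rtranclp.cases) auto
  from s(2) show ?thesis
    by cases (use s(1) that in \<open>auto simp: cut_reachable_def\<close>)
qed

text \<open>No step leaves an output state, so an infinite run only ever adds cuts. Each iterate
  then obeys all earlier cuts, and the accuracy condition keeps the \<open>z\<close> in a bounded
  set, as \<open>no_infinite_separating_sequence\<close> requires.\<close>

lemma cut_run_finite:
  assumes "bounded C" "closed C" "C \<noteq> {}" "e2 > 0"
  shows "\<nexists>s. s 0 = Iterating [] \<and> (\<forall>i::nat. cut_step c A b C J e1 e2 (s i) (s (Suc i)))"
proof
  assume "\<exists>s. s 0 = Iterating [] \<and> (\<forall>i::nat. cut_step c A b C J e1 e2 (s i) (s (Suc i)))"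
  then obtain s where s: "\<And>i::nat. cut_step c A b C J e1 e2 (s i) (s (Suc i))" by blast
  have "\<exists>L x z. s i = Iterating L \<and> s (Suc i) = Iterating (L @ [(x, z)]) \<and>
      x \<in> master_feasible_set A b J L \<and> valid_cut C e1 e2 (x, z)" for i
  proof -
    \<comment> \<open>The step after this one shows that this one did not stop.\<close>
    obtain L' where L': "s (Suc i) = Iterating L'"
      using s[of "Suc i"] by cases auto
    from s[of i] show ?thesis
      by cases (use L' in \<open>auto simp: valid_cut_def optimal_solution_def is_arg_min_def\<close>)
  qed
  then obtain L X Z where LXZ: "\<And>i. s i = Iterating (L i)"
    "\<And>i. s (Suc i) = Iterating (L i @ [(X i, Z i)])"
    "\<And>i. X i \<in> master_feasible_set A b J (L i)" "\<And>i. valid_cut C e1 e2 (X i, Z i)"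
    by metis
  have LSuc: "L (Suc i) = L i @ [(X i, Z i)]" for i
    using LXZ(1)[of "Suc i"] LXZ(2)[of i] by simp
  have mem: "(X n, Z n) \<in> set (L m)" if "n < m" for m n
    using that by (induction m) (auto simp: LSuc less_Suc_eq)
  have "range Z \<subseteq> enlarge e1 C"
    using LXZ(4) by (auto simp: valid_cut_def accurate_solution_def)
  then have "bounded (range Z)"
    using bounded_enlarge[OF assms(1)] bounded_subset by blast
  moreover have "sqrt (e2 / 2) \<le> norm (X n - Z n)" for n
    using LXZ(4)[of n] by (intro real_le_lsqrt) (auto simp: valid_cut_def norm_minus_commute)
  moreover have "(X n - Z n) \<bullet> X m \<le> (X n - Z n) \<bullet> Z n" if "n < m" for m n
    using LXZ(3)[of m] mem[OF that] by (auto simp: master_feasible_set_def)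
  ultimately show False
    using no_infinite_separating_sequence[of Z "sqrt (e2 / 2)" X] assms(4) by simp
qed

text \<open>The exact projection is an admissible oracle answer, so some rule applies once the
  master problem is settled.\<close>

lemma cut_step_exists:
  assumes "closed C" "C \<noteq> {}" "e1 > 0"
    and opt: "master_feasible_set A b J cuts \<noteq> {} \<Longrightarrow>
      \<exists>x. optimal_solution (\<lambda>y. c \<bullet> y) (master_feasible_set A b J cuts) x"
  shows "\<exists>s. cut_step c A b C J e1 e2 (Iterating cuts) s"
proof (cases "master_feasible_set A b J cuts = {}")
  case True
  then show ?thesis by (blast intro: cut_step.infeasible)
next
  case False
  then obtain x where x: "optimal_solution (\<lambda>y. c \<bullet> y) (master_feasible_set A b J cuts) x"
    using opt by blast
  have "closest_point C x \<in> enlarge e1 C"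
    using closest_point_in_set[OF assms(1,2)] enlarge_superset[of e1 C] assms(3) by auto
  then have "accurate_solution (\<lambda>y. (norm (y - x))\<^sup>2) UNIV C e1 e1 (closest_point C x)"
    using assms by (simp add: accurate_projection_iff)
  then show ?thesis
    using x cut_step.return_member cut_step.return_close cut_step.add_cut
    by (metis not_less)
qed

text \<open>The inclusion serves twice: an empty master set forces the shrunken problem to be
  infeasible, and a master optimum is no worse than any point feasible for the shrunken
  problem.\<close>

lemma shrink_subset_master:
  assumes C: "convex C" "closed C" and diam: "\<And>v w. v \<in> C \<Longrightarrow> w \<in> C \<Longrightarrow> norm (v - w) \<le> D"
    and D: "D \<ge> 1" and e: "0 < e" "e < 1 / 64"
    and reach: "cut_reachable c A b C J (e\<^sup>2) e (Iterating cuts)"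
  shows "mip_feasible_set A b (shrink (20 * D * sqrt e) C) J \<subseteq> master_feasible_set A b J cuts"
proof
  fix y assume y: "y \<in> mip_feasible_set A b (shrink (20 * D * sqrt e) C) J"
  then have ys: "y \<in> shrink (20 * D * sqrt e) C" by (simp add: mip_feasible_set_def)
  have ball: "cball y (20 * D * sqrt e) \<subseteq> C"
    using cball_subset_of_mem_shrink[OF ys] D e by simp
  have "C \<noteq> {}" using ys by (auto simp: shrink_def)
  have "(x - z) \<bullet> y \<le> (x - z) \<bullet> z" if "(x, z) \<in> set cuts" for x z
    using reachable_cuts_valid[OF reach] that \<open>C \<noteq> {}\<close> C(2)
    by (intro projection_cut_valid[OF C diam D e _ _ _ ball])
       (auto simp: valid_cut_def accurate_projection_iff)
  then show "y \<in> master_feasible_set A b J cuts"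
    using y by (auto simp: mip_feasible_set_def master_feasible_set_def)
qed

text \<open>Both \<open>x\<close> to \<open>z\<close> and \<open>z\<close> to some point of
  \<open>C\<close> are distances of at most \<open>sqrt e\<close>, so already
  \<open>2 * sqrt e\<close> suffices.\<close>

lemma returned_mem_enlarge:
  assumes "x \<in> C \<or>
      (\<exists>z. accurate_solution (\<lambda>y. (norm (y - x))\<^sup>2) UNIV C (e\<^sup>2) (e\<^sup>2) z \<and> (norm (z - x))\<^sup>2 \<le> e / 2)"
    and D: "D \<ge> 1" and e: "0 < e" "e < 1"
  shows "x \<in> enlarge (20 * D * sqrt e) C"
  using assms(1)
proof
  assume "x \<in> C"
  then show ?thesis using enlarge_superset[of "20 * D * sqrt e" C] D e by auto
next
  assume "\<exists>z. accurate_solution (\<lambda>y. (norm (y - x))\<^sup>2) UNIV C (e\<^sup>2) (e\<^sup>2) z \<and> (norm (z - x))\<^sup>2 \<le> e / 2"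
  then obtain z w where z: "(norm (z - x))\<^sup>2 \<le> e / 2" and w: "w \<in> C" "norm (z - w) \<le> e\<^sup>2"
    by (auto simp: accurate_solution_def enlarge_def)
  have "norm (z - x) \<le> sqrt e"
    using z e by (intro real_le_rsqrt) linarith
  moreover have "e\<^sup>2 \<le> sqrt e"
  proof (rule real_le_rsqrt)
    show "(e\<^sup>2)\<^sup>2 \<le> e"
      using e power_decreasing[of 1 4 e] by (simp flip: power_mult)
  qed
  ultimately have "norm (x - w) \<le> 2 * sqrt e"
    using w(2) norm_triangle_ineq[of "x - z" "z - w"] by (simp add: norm_minus_commute)
  also have "\<dots> \<le> 20 * D * sqrt e"
    using D e by (intro mult_right_mono) auto
  finally show ?thesis using w(1) unfolding enlarge_def by blast
qed

text \<open>Both the optimal value and the value at \<open>x\<close> lie between the values at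
  \<open>x1\<close> and \<open>x2\<close>. Stability and Cauchy-Schwarz bound that gap by
  \<open>lam * \<epsilon> * norm c\<close>.\<close>

lemma accurate_of_sandwich:
  assumes stable: "mip_stable (\<lambda>y. c \<bullet> y) A b C J \<epsilon> lam" and "0 \<le> \<epsilon>"
    and x: "x \<in> mip_feasible_set A b (enlarge \<epsilon> C) J"
    and le: "\<And>y. y \<in> mip_feasible_set A b (shrink \<epsilon> C) J \<Longrightarrow> c \<bullet> x \<le> c \<bullet> y"
  shows "mip_accurate_solution (\<lambda>y. c \<bullet> y) A b C J (lam * \<epsilon> * norm c) \<epsilon> lam x"
proof -
  let ?F = "\<lambda>S. mip_feasible_set A b S J"
  obtain x1 x2 where x12: "optimal_solution (\<lambda>y. c \<bullet> y) (?F (enlarge \<epsilon> C)) x1"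
    "optimal_solution (\<lambda>y. c \<bullet> y) (?F (shrink \<epsilon> C)) x2" "norm (x1 - x2) \<le> lam * \<epsilon>"
    using stable unfolding mip_stable_def by blast
  have x1: "c \<bullet> x1 \<le> c \<bullet> y" if "y \<in> ?F (enlarge \<epsilon> C)" for y
    using x12(1) that by (auto simp: optimal_solution_def is_arg_min_linorder)
  have x2: "x2 \<in> ?F (shrink \<epsilon> C)"
    using x12(2) by (simp add: optimal_solution_def is_arg_min_def)
  have sub: "?F (shrink \<epsilon> C) \<subseteq> ?F C" "?F C \<subseteq> ?F (enlarge \<epsilon> C)"
    using enlarge_superset[OF \<open>0 \<le> \<epsilon>\<close>, of C] by (auto simp: mip_feasible_set_def shrink_def)
  have "c \<bullet> (x2 - x1) \<le> norm c * norm (x2 - x1)" by (rule norm_cauchy_schwarz)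
  also have "\<dots> \<le> lam * \<epsilon> * norm c"
    using mult_left_mono[OF x12(3) norm_ge_zero[of c]] by (simp add: norm_minus_commute mult.commute)
  finally have gap: "c \<bullet> x2 \<le> c \<bullet> x1 + lam * \<epsilon> * norm c" by (simp add: inner_diff_right)
  have lower: "ereal (c \<bullet> x1) \<le> opt_value (\<lambda>y. c \<bullet> y) (?F C)"
    unfolding opt_value_def using x1 sub by (intro INF_greatest) auto
  have upper: "opt_value (\<lambda>y. c \<bullet> y) (?F C) \<le> ereal (c \<bullet> x2)"
    unfolding opt_value_def using x2 sub by (intro INF_lower) auto
  \<comment> \<open>Real bounds on both sides rule out infinite values of
    \<open>opt_value\<close>.\<close>
  obtain v where v: "opt_value (\<lambda>y. c \<bullet> y) (?F C) = ereal v"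
    using lower upper by (cases "opt_value (\<lambda>y. c \<bullet> y) (?F C)") auto
  have "v - lam * \<epsilon> * norm c \<le> c \<bullet> x" "c \<bullet> x \<le> v + lam * \<epsilon> * norm c"
    using lower upper gap x1[OF x] le[OF x2] v by auto
  then show ?thesis
    using stable x v by (auto simp: mip_accurate_solution_def mip_feasible_set_def)
qed

theorem theoremC1:
  fixes A :: "real ^ 'n ^ 'm" and b :: "real ^ 'm" and c a :: "real ^ 'n"
    and C :: "(real ^ 'n) set" and J :: "'n set" and D e1 e2 :: real
  assumes "convex C" and "closed C" and "bounded C"
    and "aff_dim C = int CARD('n)"
    and "C \<subseteq> cball a (D / 2)" and "D \<ge> 1"
    and "e1 > 0" and "e2 > 0" and "e1 = e2\<^sup>2" and "e2 < 1 / 64 * min 1 D"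
  shows "cut_terminates c A b C J e1 e2 \<and>
    (cut_reachable c A b C J e1 e2 Infeasible \<longrightarrow>
       mip_eps_infeasible A b C J (20 * D * sqrt e2)) \<and>
    (\<forall>x. cut_reachable c A b C J e1 e2 (Returned x) \<longrightarrow>
       (\<forall>lam>0. mip_stable (\<lambda>y. c \<bullet> y) A b C J (20 * D * sqrt e2) lam \<longrightarrow>
          mip_accurate_solution (\<lambda>y. c \<bullet> y) A b C J
            (20 * lam * D * sqrt e2 * norm c) (20 * D * sqrt e2) lam x))"
proof -
  \<comment> \<open>The empty set has affine dimension -1.\<close>
  have ne: "C \<noteq> {}" using assms(4) by auto
  have e: "e2 < 1 / 64" using assms(6,10) by simp
  have diam: "norm (v - w) \<le> D" if "v \<in> C" "w \<in> C" for v w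
  proof -
    have "dist a v \<le> D / 2" "dist a w \<le> D / 2" using that assms(5) by auto
    then show ?thesis
      using dist_triangle3[of v w a] by (simp add: dist_norm)
  qed
  note sub = shrink_subset_master[OF assms(1,2) diam assms(6,8) e, of c A b J]
  let ?\<epsilon> = "20 * D * sqrt e2"
  have \<epsilon>0: "0 \<le> ?\<epsilon>" using assms(6,8) by simp
  have "cut_terminates c A b C J e1 e2"
    unfolding cut_terminates_def
    using cut_run_finite[OF assms(3,2) ne assms(8)] cut_step_exists[OF assms(2) ne assms(7)] by blast
  moreover have "mip_eps_infeasible A b C J ?\<epsilon>"
    if "cut_reachable c A b C J e1 e2 Infeasible"
    using that
  proof (rule reachable_InfeasibleE)
    fix cuts assume "cut_reachable c A b C J e1 e2 (Iterating cuts)"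
      "master_feasible_set A b J cuts = {}"
    then show ?thesis using sub assms(9) unfolding mip_eps_infeasible_def by blast
  qed
  moreover have "mip_accurate_solution (\<lambda>y. c \<bullet> y) A b C J
      (20 * lam * D * sqrt e2 * norm c) ?\<epsilon> lam x"
    if x: "cut_reachable c A b C J e1 e2 (Returned x)"
      and stable: "mip_stable (\<lambda>y. c \<bullet> y) A b C J ?\<epsilon> lam" for x lam
  proof -
    obtain cuts where cuts: "cut_reachable c A b C J e1 e2 (Iterating cuts)"
      and opt: "optimal_solution (\<lambda>y. c \<bullet> y) (master_feasible_set A b J cuts) x"
      and near: "x \<in> C \<or> (\<exists>z. accurate_solution (\<lambda>y. (norm (y - x))\<^sup>2) UNIV C e1 e1 z \<and>
        (norm (z - x))\<^sup>2 \<le> e2 / 2)"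
      using x by (rule reachable_ReturnedE)
    have "x \<in> enlarge ?\<epsilon> C"
      using returned_mem_enlarge[OF near[unfolded assms(9)] assms(6,8)] e by simp
    then have "x \<in> mip_feasible_set A b (enlarge ?\<epsilon> C) J"
      using opt by (auto simp: optimal_solution_def is_arg_min_def mip_feasible_set_def
          master_feasible_set_def)
    moreover have "c \<bullet> x \<le> c \<bullet> y" if "y \<in> mip_feasible_set A b (shrink ?\<epsilon> C) J" for y
      using sub cuts opt that assms(9) by (auto simp: optimal_solution_def is_arg_min_linorder)
    ultimately have "mip_accurate_solution (\<lambda>y. c \<bullet> y) A b C J (lam * ?\<epsilon> * norm c) ?\<epsilon> lam x"
      by (rule accurate_of_sandwich[OF stable \<epsilon>0])
    moreover have "lam * ?\<epsilon> * norm c = 20 * lam * D * sqrt e2 * norm c" by simp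
    ultimately show ?thesis by metis
  qed
  ultimately show ?thesis by blast
qed

end
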